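(* Every rational number in $(0,1)$ is the commuting degree of some finite non-commutative BCK-algebra. That is, $$\bigcup_{n=3}^{\infty}\mathcal{CD}(n)=\mathbb{Q}\cap(0,1),$$ where $\mathcal{CD}(n)=\bigl\{\frac{3n-2}{n^2},\frac{3n}{n^2},\frac{3n+2}{n^2},\ldots,\frac{n^2-2}{n^2}\bigr\}$.
   Context: A BCK-algebra is an algebra $\mathbf{A}=\langle A;\cdot,0\rangle$ of type $(2,0)$ such that for all $x,y,z\in A$: (BCK1) $[(x\cdot y)\cdot(x\cdot z)]\cdot(z\cdot y)=0$; (BCK2) $[x\cdot(x\cdot y)]\cdot y=0$; (BCK3) $x\cdot x=0$; (BCK4) $0\cdot x=0$; (BCK5) $x\cdot y=0$ and $y\cdot x=0$ imply $x=y$. The order of $\mathbf{A}$ is $|\mathbf{A}|=|A|$. Define $x\wedge y:=y\cdot(y\cdot x)$. Elements $x,y$ commute if $x\wedge y=y\wedge x$; $\mathbf{A}$ is commutative if all pairs of elements commute, and non-commutative otherwise. For a finite BCK-algebra $\mathbf{A}$, let $C(\mathbf{A})=\{(x,y)\in A^2 : x\wedge y=y\wedge x\}$; the commuting degree of $\mathbf{A}$ is $\operatorname{cd}(\mathbf{A})=\frac{|C(\mathbf{A})|}{|\mathbf{A}|^2}$. For $n\geq 3$, $\mathcal{CD}(n)$ is the set of a priori possible commuting degrees of a non-commutative BCK-algebra of order $n$: the numerators increase in steps of $2$ from $3n-2$ to $n^2-2$ (these two integers have the same parity). Equivalently, $\mathcal{CD}(n)=\bigl\{\frac{n^2-2k}{n^2}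 : k\in\mathbb{Z},\ 1\leq k\leq T_{n-2}\bigr\}$, where $T_{n-2}=\frac{(n-2)(n-1)}{2}$. *)

theory Defs
  imports Complex_Main
begin

locale bck_algebra =
  fixes A :: "'a set" and mul :: "'a \<Rightarrow> 'a \<Rightarrow> 'a" (infixl \<open>\<cdot>\<close> 70) and zero :: 'a (\<open>\<zero>\<close>)
  assumes mul_closed: "x \<in> A \<Longrightarrow> y \<in> A \<Longrightarrow> x \<cdot> y \<in> A"
    and zero_closed: "\<zero> \<in> A"
    and bck1: "x \<in> A \<Longrightarrow> y \<in> A \<Longrightarrow> z \<in> A \<Longrightarrow> ((x \<cdot> y) \<cdot> (x \<cdot> z)) \<cdot> (z \<cdot> y) = \<zero>"
    and bck2: "x \<in> A \<Longrightarrow> y \<in> A \<Longrightarrow> (x \<cdot> (x \<cdot> y)) \<cdot> y = \<zero>"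
    and bck3: "x \<in> A \<Longrightarrow> x \<cdot> x = \<zero>"
    and bck4: "x \<in> A \<Longrightarrow> \<zero> \<cdot> x = \<zero>"
    and bck5: "x \<in> A \<Longrightarrow> y \<in> A \<Longrightarrow> x \<cdot> y = \<zero> \<Longrightarrow> y \<cdot> x = \<zero> \<Longrightarrow> x = y"

definition bck_meet :: "('a \<Rightarrow> 'a \<Rightarrow> 'a) \<Rightarrow> 'a \<Rightarrow> 'a \<Rightarrow> 'a" where
  "bck_meet mul x y = mul y (mul y x)"

definition commuting_pairs :: "'a set \<Rightarrow> ('a \<Rightarrow> 'a \<Rightarrow> 'a) \<Rightarrow> ('a \<times> 'a) set" where
  "commuting_pairs A mul = {(x, y). x \<in> A \<and> y \<in> A \<and> bck_meet mul x y = bck_meet mul y x}"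

definition bck_commutative :: "'a set \<Rightarrow> ('a \<Rightarrow> 'a \<Rightarrow> 'a) \<Rightarrow> bool" where
  "bck_commutative A mul \<longleftrightarrow> (\<forall>x\<in>A. \<forall>y\<in>A. bck_meet mul x y = bck_meet mul y x)"

definition commuting_degree :: "'a set \<Rightarrow> ('a \<Rightarrow> 'a \<Rightarrow> 'a) \<Rightarrow> real" where
  "commuting_degree A mul = real (card (commuting_pairs A mul)) / real (card A) ^ 2"

text \<open>The a priori possible commuting degrees in order \<open>n\<close> (meaningful for \<open>n \<ge> 3\<close>): the
  numerators run from \<open>3n - 2\<close> to \<open>n\<^sup>2 - 2\<close> in steps of two.\<close>

definition CD :: "nat \<Rightarrow> real set" where
  "CD n = {real_of_int m / real n ^ 2 | m :: int.
             3 * int n - 2 \<le> m \<and> m \<le> int n ^ 2 - 2 \<and> even (m - (3 * int n - 2))}"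

lemma CD_altdef:
  assumes "n \<ge> 3"
  shows "CD n = {(real n ^ 2 - 2 * real_of_int k) / real n ^ 2 | k :: int.
                   1 \<le> k \<and> k \<le> (int n - 2) * (int n - 1) div 2}"
proof -
  let ?T = "(int n - 2) * (int n - 1) div 2"
  have "even ((int n - 2) * (int n - 1))" by simp
  then have T: "2 * ?T = int n ^ 2 - 3 * int n + 2"
    by (simp add: algebra_simps power2_eq_square)
  have par: "even (m - (3 * int n - 2)) \<longleftrightarrow> even (int n ^ 2 - m)" for m by auto
  show ?thesis
  proof (intro set_eqI iffI)
    fix q assume "q \<in> CD n"
    then obtain m where q: "q = real_of_int m / real n ^ 2"
      and m: "3 * int n - 2 \<le> m" "m \<le> int n ^ 2 - 2" "even (int n ^ 2 - m)"
      unfolding CD_def par by blast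
    from m(3) obtain k where k: "int n ^ 2 - m = 2 * k" by (rule evenE)
    have "m = int n ^ 2 - 2 * k" using k by simp
    then have "q = (real n ^ 2 - 2 * real_of_int k) / real n ^ 2" using q by simp
    moreover have "1 \<le> k" "k \<le> ?T" using k m T by linarith+
    ultimately show "q \<in> {(real n ^ 2 - 2 * real_of_int k) / real n ^ 2 | k :: int. 1 \<le> k \<and> k \<le> ?T}"
      by blast
  next
    fix q assume "q \<in> {(real n ^ 2 - 2 * real_of_int k) / real n ^ 2 | k :: int. 1 \<le> k \<and> k \<le> ?T}"
    then obtain k where q: "q = (real n ^ 2 - 2 * real_of_int k) / real n ^ 2"
      and k: "1 \<le> k" "k \<le> ?T" by blast
    have "q = real_of_int (int n ^ 2 - 2 * k) / real n ^ 2" using q by simp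
    moreover have "3 * int n - 2 \<le> int n ^ 2 - 2 * k" "int n ^ 2 - 2 * k \<le> int n ^ 2 - 2"
      using k T by linarith+
    moreover have "even (int n ^ 2 - (int n ^ 2 - 2 * k))" by simp
    ultimately show "q \<in> CD n" unfolding CD_def par by blast
  qed
qed

end

theory Submission imports Defs begin

text \<open>Every poset with least element \<open>0\<close> is a BCK-algebra under the product that is \<open>0\<close> if
  \<open>x \<le> y\<close> and \<open>x\<close> otherwise; two elements fail to commute exactly if they are nonzero and strictly
  comparable. On \<open>{0, \<dots>, n - 1}\<close>, a function \<open>h\<close> with \<open>h y < y\<close> for \<open>y > 0\<close> yields such an order, in
  which the elements strictly below \<open>y\<close> are \<open>0, \<dots>, h y\<close>. It has \<open>\<Sum>y<n. h y\<close> non-commuting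
  unordered pairs, and this sum takes every value from \<open>0\<close> to \<open>(n - 2)(n - 1) / 2\<close>.
  So each element of \<open>CD n\<close> is a commuting degree, and a rational \<open>a / b\<close> in \<open>(0, 1)\<close>
  lies in \<open>CD (4 b)\<close>.\<close>

definition threshold_mul :: "(nat \<Rightarrow> nat) \<Rightarrow> nat \<Rightarrow> nat \<Rightarrow> nat" where
  "threshold_mul h x y = (if x = y \<or> x \<le> h y then 0 else x)"

lemma bck_algebra_threshold:
  assumes "\<And>y. h y \<le> y" and "n > 0"
  shows "bck_algebra {..<n} (threshold_mul h) 0"
proof
  fix x y z
  \<comment> \<open>Transitivity of the order. It settles the one critical case of
    \<open>bck1\<close>: x below z but not below y, so z is not below y either.\<close>
  have "x \<le> h y" if "x \<le> h z" "z \<le> h y"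
    using that assms(1)[of z] by linarith
  then show "threshold_mul h (threshold_mul h (threshold_mul h x y) (threshold_mul h x z))
      (threshold_mul h z y) = 0"
    by (auto simp: threshold_mul_def)
  show "x = y" if "threshold_mul h x y = 0" "threshold_mul h y x = 0"
    using that assms(1)[of x] assms(1)[of y]
    by (auto simp: threshold_mul_def split: if_splits)
qed (use assms(2) in \<open>auto simp: threshold_mul_def\<close>)

text \<open>\<open>bck_meet (threshold_mul h) x y\<close> is y if y lies below x, and 0 otherwise.
  Truncated subtraction makes the bound force \<open>h 0 = 0\<close>.\<close>

lemma threshold_meet_commute_iff:
  assumes h: "\<And>y. h y \<le> y - 1"
  shows "bck_meet (threshold_mul h) x y = bck_meet (threshold_mul h) y x \<longleftrightarrow>
    \<not> (0 < x \<and> x \<le> h y) \<and> \<not> (0 < y \<and> y \<le> h x)"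
  using h[of x] h[of y] h[of 0] by (auto simp: bck_meet_def threshold_mul_def)

lemma card_commuting_pairs_threshold:
  assumes h: "\<And>y. h y \<le> y - 1"
  shows "card (commuting_pairs {..<n} (threshold_mul h)) + 2 * (\<Sum>y<n. h y) = n ^ 2"
proof -
  let ?C = "commuting_pairs {..<n} (threshold_mul h)"
  \<comment> \<open>Non-commuting pairs with the larger element first; the swapped copy supplies the
    other orientation, hence the factor 2. Starting at 1 leaves out the zero element.\<close>
  let ?S = "SIGMA y:{..<n}. {1..h y}"
  have lt: "x < y" if "0 < x" "x \<le> h y" for x y
    using that h[of y] by linarith
  have lt_n: "x < n" if "0 < x" "x \<le> h y" "y < n" for x y
    using lt[OF that(1,2)] that(3) by simp
  have "?S \<subseteq> {..<n} \<times> {..<n}"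
    using lt_n by (auto simp: Suc_le_eq)
  then have "{..<n} \<times> {..<n} = ?C \<union> (?S \<union> prod.swap ` ?S)"
    by (auto simp: commuting_pairs_def threshold_meet_commute_iff[OF h] image_iff Suc_le_eq)
  moreover have "?C \<inter> (?S \<union> prod.swap ` ?S) = {}"
    by (auto simp: commuting_pairs_def threshold_meet_commute_iff[OF h])
  moreover have "finite ?C"
    by (rule finite_subset[of _ "{..<n} \<times> {..<n}"]) (auto simp: commuting_pairs_def)
  ultimately have "card ({..<n} \<times> {..<n}) = card ?C + card (?S \<union> prod.swap ` ?S)"
    by (simp add: card_Un_disjoint)
  also have "card (?S \<union> prod.swap ` ?S) = card ?S + card (prod.swap ` ?S)"
  proof (rule card_Un_disjoint)
    have "snd p < fst p" if "p \<in> ?S" for p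
      using that lt by (auto simp: Suc_le_eq)
    moreover from this have "fst p < snd p" if "p \<in> prod.swap ` ?S" for p
      using that by fastforce
    ultimately show "?S \<inter> prod.swap ` ?S = {}"
      by (meson disjoint_iff less_not_sym)
  qed auto
  also have "card (prod.swap ` ?S) = card ?S"
    by (rule card_image) simp
  also have "card ?S = (\<Sum>y<n. h y)"
    by simp
  finally show ?thesis
    by (simp add: power2_eq_square)
qed

lemma exists_bounded_summands:
  fixes f :: "nat \<Rightarrow> nat"
  assumes "k \<le> (\<Sum>y<n. f y)"
  shows "\<exists>h. (\<forall>y. h y \<le> f y) \<and> (\<Sum>y<n. h y) = k"
  using assms
proof (induction n arbitrary: k)
  case 0
  then show ?case by auto
next
  case (Suc n)
  \<comment> \<open>Greedy choice: the earlier summands absorb as much of k as they can, and what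
    remains is at most \<open>f n\<close>.\<close>
  define j where "j = min k (\<Sum>y<n. f y)"
  obtain h where h: "\<And>y. h y \<le> f y" "(\<Sum>y<n. h y) = j"
    using Suc.IH[of j] by (auto simp: j_def)
  have "k - j \<le> f n" "j + (k - j) = k"
    using Suc.prems by (auto simp: j_def)
  then have "\<forall>y. (h(n := k - j)) y \<le> f y" "(\<Sum>y<Suc n. (h(n := k - j)) y) = k"
    using h by auto
  then show ?case by blast
qed

text \<open>The extreme case \<open>h y = y - 1\<close> is the chain; its count of non-commuting
  pairs is the upper bound for k in \<open>CD_altdef\<close>.\<close>

lemma sum_pred_lessThan: "2 * int (\<Sum>y<n. y - 1) = (int n - 2) * (int n - 1)" if "n > 0"
  using that
proof (induction n rule: nat_induct_non_zero)
  case (Suc n)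
  then show ?case by (simp add: algebra_simps)
qed simp

lemma CD_commuting_degree:
  assumes n: "n \<ge> 3" and q: "q \<in> CD n"
  obtains h where "bck_algebra {..<n} (threshold_mul h) 0"
    "commuting_degree {..<n} (threshold_mul h) = q"
proof -
  obtain k :: int where k: "1 \<le> k" "k \<le> (int n - 2) * (int n - 1) div 2"
    and qk: "q = (real n ^ 2 - 2 * real_of_int k) / real n ^ 2"
    using q unfolding CD_altdef[OF n] by blast
  have "nat k \<le> (\<Sum>y<n. y - 1)"
    using k sum_pred_lessThan[of n] n by linarith
  then obtain h where h: "\<And>y. h y \<le> y - 1" "(\<Sum>y<n. h y) = nat k"
    using exists_bounded_summands by blast
  have "h y \<le> y" for y
    using h(1)[of y] by linarith
  then have "bck_algebra {..<n} (threshold_mul h) 0"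
    using n by (intro bck_algebra_threshold) auto
  moreover have "real (card (commuting_pairs {..<n} (threshold_mul h))) = real n ^ 2 - 2 * real_of_int k"
    using arg_cong[OF card_commuting_pairs_threshold[of h n, OF h(1)], of real] h(2) k(1)
    by simp
  ultimately show thesis
    using that by (simp add: commuting_degree_def qk)
qed

lemma CD_subset:
  assumes "n \<ge> 3"
  shows "CD n \<subseteq> \<rat> \<inter> {0<..<1}"
proof
  fix q assume "q \<in> CD n"
  then obtain m :: int where q: "q = real_of_int m / real n ^ 2"
    and m: "3 * int n - 2 \<le> m" "m \<le> int n ^ 2 - 2"
    unfolding CD_def by blast
  have "0 < m" using m(1) assms by linarith
  moreover have "real_of_int m < real n ^ 2"
    using m(2) by (metis diff_less_eq less_add_same_cancel1 of_int_less_iff of_int_of_nat_eq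
        of_int_power order_le_less_trans zero_less_numeral)
  ultimately show "q \<in> \<rat> \<inter> {0<..<1}"
    using assms by (auto simp: q)
qed

lemma Rats_in_CD:
  assumes "q \<in> \<rat>" "0 < q" "q < 1"
  obtains n where "n \<ge> 3" "q \<in> CD n"
proof -
  obtain a b :: int where b: "b > 0" and q: "q = real_of_int a / real_of_int b"
    using Rats_cases'[OF assms(1)] by metis
  have a: "0 < a" "a < b"
    using assms(2,3) b by (auto simp: q zero_less_divide_iff)
  \<comment> \<open>Over the denominator \<open>16 * b^2\<close> the numerator is
    \<open>16 * a * b\<close>. The factor 4 makes n even, settling parity, and gives 12b - 2 \<le>
    16ab as a \<ge> 1. The upper bound comes from a + 1 \<le> b.\<close>
  define n where "n = nat (4 * b)"
  have n: "int n = 4 * b" "real n = 4 * real_of_int b"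
    using b by (auto simp: n_def)
  have "3 * int n - 2 \<le> 16 * a * b"
  proof -
    have "b \<le> a * b" using a b by simp
    then show ?thesis using b unfolding n by linarith
  qed
  moreover have "16 * a * b \<le> int n ^ 2 - 2"
    using a b mult_right_mono[of "a + 1" b b] by (simp add: n power2_eq_square algebra_simps)
  moreover have "even (16 * a * b - (3 * int n - 2))"
    by (simp add: n)
  moreover have "q = real_of_int (16 * a * b) / real n ^ 2"
    using b by (simp add: q n power2_eq_square field_simps)
  ultimately have "q \<in> CD n"
    unfolding CD_def by blast
  moreover have "n \<ge> 3" using n(1) b by linarith
  ultimately show thesis using that by blast
qed

text \<open>If all pairs commute, numerator and denominator agree and the degree is 1.\<close>

lemma not_bck_commutative_if_degree_less_1:
  assumes "finite A" "A \<noteq> {}" "commuting_degree A mul < 1"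
  shows "\<not> bck_commutative A mul"
proof
  assume "bck_commutative A mul"
  then have "commuting_pairs A mul = A \<times> A"
    by (auto simp: commuting_pairs_def bck_commutative_def)
  then show False
    using assms by (simp add: commuting_degree_def card_cartesian_product power2_eq_square)
qed

theorem theorem3p8:
  shows "(\<forall>q \<in> \<rat> \<inter> {0<..<1::real}.
            \<exists>(A :: nat set) mul zero.
              bck_algebra A mul zero \<and> finite A \<and> \<not> bck_commutative A mul \<and>
              commuting_degree A mul = q)
         \<and> (\<Union>n\<in>{3..}. CD n) = \<rat> \<inter> {0<..<1::real}"
proof (intro conjI ballI)
  fix q :: real assume q: "q \<in> \<rat> \<inter> {0<..<1}"
  then obtain n where n: "n \<ge> 3" "q \<in> CD n"
    using Rats_in_CD by auto
  then obtain h where h: "bck_algebra {..<n} (threshold_mul h) 0"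
    "commuting_degree {..<n} (threshold_mul h) = q"
    by (rule CD_commuting_degree)
  moreover have "\<not> bck_commutative {..<n} (threshold_mul h)"
    using n(1) q h(2) by (intro not_bck_commutative_if_degree_less_1) (auto simp: lessThan_empty_iff)
  ultimately show "\<exists>(A :: nat set) mul zero. bck_algebra A mul zero \<and> finite A \<and>
      \<not> bck_commutative A mul \<and> commuting_degree A mul = q"
    by blast
next
  show "(\<Union>n\<in>{3..}. CD n) = \<rat> \<inter> {0<..<1::real}"
    using CD_subset by (fastforce elim: Rats_in_CD)
qed

end
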